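(* Fix $\rho\in\mathbb{Q}$ with $-1<\rho<1$ and $u\in\mathbb{Q}$ with $-\sqrt{1-\rho^2}<u<0$. Suppose that $(k\tau(q),\iota(u))$ is a genuine pair. Then any other solution $k'\tau(q')$ for the same fixed isosceles triangle $\iota(u)$ is congruent to $k\tau(q)$. More precisely, the only possible second set of parameters is \[ q'=\frac{2\rho-1-q}{1-q},\qquad k'=1-q, \] and \[ k'\tau(q')=\bigl(k(1-q^2),\,2k(\rho-q),\,k(q^2-2\rho q+1)\bigr). \] Thus $k'\tau(q')$ is obtained from $k\tau(q)$ simply by interchanging the first two sides. In particular, a fixed isosceles triangle has at most one genuine $\theta$-triangle partner up to congruence (where $\cos\theta=\rho$).
   Context: For $\rho\in\mathbb{Q}\cap(-1,1)$ and $q,u\in\mathbb{Q}$ consider triangles given by their triples of side lengths: \[ \tau(q)=\bigl(2(\rho-q),\,1-q^{2},\,q^{2}-2\rho q+1\bigr),\qquad \iota(u)=\bigl(2(1-\rho^{2}-u^{2}),\,u^{2}-\rho^{2}+1,\,u^{2}-\rho^{2}+1\bigr). \] The angle between the first two sides of $\tau(q)$ is the angle $\theta$ with $\cos\theta=\rho$; a rational triangle with an angle $\theta$ is called a $\theta$-triangle. The triangle $\tau(q)$ is non-degenerate iff $|q|<1$ and $q<\rho$; $\iota(u)$ is an isosceles triangle, and is taken to be non-degenerate iff $-\sqrt{1-\rho^2}<u<0$. For $k\in\mathbb{Q}^\times$, $k\tau(q)$ is the rescaled triangle. A solution for $\iota(u)$ is a pair of rationals $(k,q)$, $k\ne0$,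 (equivalently the triangle $k\tau(q)$) satisfying the equal-perimeter and equal-area system \[ k(1-q)=2(1-\rho),\qquad k^2(\rho-q)(1-q^2)=-2u(1-\rho^2-u^2). \] The pair $(k\tau(q),\iota(u))$ is a genuine pair if this system holds, both triangles are non-degenerate, and they are not congruent; then $k\tau(q)$ is called a genuine $\theta$-triangle partner of $\iota(u)$. *)

theory Defs
  imports Complex_Main "HOL-Library.Multiset"
begin

text \<open>A triangle is given by its triple of side lengths; the order of the sides matters only
  for equality of triples, not for congruence.\<close>

type_synonym triangle = "rat \<times> rat \<times> rat"

fun scale_triangle :: "rat \<Rightarrow> triangle \<Rightarrow> triangle" where
  "scale_triangle k (a, b, c) = (k * a, k * b, k * c)"

fun swap_first_two :: "triangle \<Rightarrow> triangle" where
  "swap_first_two (a, b, c) = (b, a, c)"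

fun sides :: "triangle \<Rightarrow> rat multiset" where
  "sides (a, b, c) = {#a, b, c#}"

text \<open>Side-side-side: triangles are congruent iff their side lengths agree up to order.\<close>

definition congruent_triangles :: "triangle \<Rightarrow> triangle \<Rightarrow> bool" where
  "congruent_triangles S T \<longleftrightarrow> sides S = sides T"

text \<open>The angle between the first two sides of \<open>tau \<rho> q\<close> has cosine \<open>\<rho>\<close>.\<close>

definition tau :: "rat \<Rightarrow> rat \<Rightarrow> triangle" where
  "tau \<rho> q = (2 * (\<rho> - q), 1 - q^2, q^2 - 2 * \<rho> * q + 1)"

definition iota :: "rat \<Rightarrow> rat \<Rightarrow> triangle" where
  "iota \<rho> u = (2 * (1 - \<rho>^2 - u^2), u^2 - \<rho>^2 + 1, u^2 - \<rho>^2 + 1)"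

text \<open>For \<open>\<bar>\<rho>\<bar> < 1\<close> the condition on \<open>q\<close> says exactly that the three entries of \<open>tau \<rho> q\<close> are
  positive; the strict triangle inequalities are then automatic by the law of cosines.\<close>

definition tau_nondegenerate :: "rat \<Rightarrow> rat \<Rightarrow> bool" where
  "tau_nondegenerate \<rho> q \<longleftrightarrow> \<bar>q\<bar> < 1 \<and> q < \<rho>"

text \<open>The triple \<open>iota \<rho> u\<close> depends only on \<open>u\<^sup>2\<close>; by convention the negative \<open>u\<close> is used, so
  that the height is \<open>- 2 u sqrt (1 - \<rho>\<^sup>2)\<close>.\<close>

definition iota_nondegenerate :: "rat \<Rightarrow> rat \<Rightarrow> bool" where
  "iota_nondegenerate \<rho> u \<longleftrightarrow> - sqrt (1 - (of_rat \<rho>)^2) < (of_rat u :: real) \<and> u < 0"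

text \<open>The two equations are equality of perimeters, divided by \<open>2 (1 + \<rho>)\<close>, and equality of
  areas, divided by \<open>sqrt (1 - \<rho>\<^sup>2)\<close>, for \<open>k tau \<rho> q\<close> and \<open>iota \<rho> u\<close>.\<close>

definition is_solution :: "rat \<Rightarrow> rat \<Rightarrow> rat \<Rightarrow> rat \<Rightarrow> bool" where
  "is_solution \<rho> u k q \<longleftrightarrow> k \<noteq> 0 \<and>
     k * (1 - q) = 2 * (1 - \<rho>) \<and>
     k^2 * (\<rho> - q) * (1 - q^2) = - 2 * u * (1 - \<rho>^2 - u^2)"

text \<open>For \<open>\<rho> < 1\<close> and \<open>\<bar>q\<bar> < 1\<close> the first equation forces \<open>k > 0\<close>, so \<open>k tau \<rho> q\<close> is
  non-degenerate as soon as \<open>tau \<rho> q\<close> is.\<close>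

definition genuine_pair :: "rat \<Rightarrow> rat \<Rightarrow> rat \<Rightarrow> rat \<Rightarrow> bool" where
  "genuine_pair \<rho> u k q \<longleftrightarrow> is_solution \<rho> u k q \<and>
     tau_nondegenerate \<rho> q \<and> iota_nondegenerate \<rho> u \<and>
     \<not> congruent_triangles (scale_triangle k (tau \<rho> q)) (iota \<rho> u)"

definition genuine_partner :: "rat \<Rightarrow> rat \<Rightarrow> triangle \<Rightarrow> bool" where
  "genuine_partner \<rho> u T \<longleftrightarrow>
     (\<exists>k q. genuine_pair \<rho> u k q \<and> T = scale_triangle k (tau \<rho> q))"

end

theory Submission
  imports Defs
begin

text \<open>Put \<open>w = 1 - q\<close> and \<open>c = 1 - \<rho>\<close>. The perimeter equation reads \<open>k w = 2 c\<close>, so \<open>k\<close> is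
  determined by \<open>w\<close>, and eliminating it turns the area, which looks cubic in \<open>q\<close>, into
  \<open>4 c\<^sup>2 (w - c) (2 - w) / w\<close>: one power of \<open>w\<close> in \<open>1 - q\<^sup>2 = w (2 - w)\<close> cancels against \<open>k\<^sup>2\<close>.
  Prescribing this value is a monic quadratic equation in \<open>w\<close> whose constant term is \<open>2 c\<close>,
  whatever the area is. Hence a second root satisfies \<open>w w' = 2 c = k w\<close>, that is \<open>w' = k\<close>, and
  then \<open>k' = 2 c / w' = w\<close>: the two solutions arise from each other by the involution
  \<open>(k, w) \<mapsto> (w, k)\<close> (lemma \<open>solution_unique_up_to_involution\<close>).

  Geometrically, the sides enclosing the angle are \<open>2 k (w - c) = 2 w k - 2 c k = 2 c (2 - k)\<close> and
  \<open>k w (2 - w) = 2 c (2 - w)\<close>, which the involution interchanges; the third side is then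
  the same as well, because the perimeter is (lemma \<open>involution_swaps_sides\<close>). So there is only one triangle up to
  congruence.\<close>

lemma solution_unique_up_to_involution:
  assumes "\<rho> \<noteq> 1" and sol: "is_solution \<rho> u k q" and sol': "is_solution \<rho> u k' q'"
  shows "(k', q') = (k, q) \<or> k' = 1 - q \<and> q' = 1 - k"
proof -
  define c w w' where "c = 1 - \<rho>" and "w = 1 - q" and "w' = 1 - q'"
  define A where "A = - 2 * u * (1 - \<rho>^2 - u^2)"
  have c: "c \<noteq> 0" using assms(1) by (simp add: c_def)
  have k: "k * w = 2 * c" and k': "k' * w' = 2 * c"
    using sol sol' by (simp_all add: is_solution_def c_def w_def w'_def)
  have w: "w \<noteq> 0" "w' \<noteq> 0" using c k k' by auto
  have eliminate_scale: "(2 * c)^2 * ((v - c) * (2 - v)) = v * A"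
    if "is_solution \<rho> u l (1 - v)" "l * v = 2 * c" for l v
  proof -
    have "l^2 * (v - c) * (v * (2 - v)) = A"
      using that(1) by (simp add: is_solution_def A_def c_def power2_eq_square algebra_simps)
    moreover have "(l * v)^2 * ((v - c) * (2 - v)) = v * (l^2 * (v - c) * (v * (2 - v)))"
      by (simp add: power2_eq_square)
    ultimately show ?thesis by (simp only: that(2))
  qed
  have "(2 * c)^2 * ((w - c) * (2 - w)) = w * A" "(2 * c)^2 * ((w' - c) * (2 - w')) = w' * A"
    using eliminate_scale[of k w] eliminate_scale[of k' w'] sol sol' k k'
    by (simp_all add: w_def w'_def)
  then have "(2 * c)^2 * (w' * ((w - c) * (2 - w))) = (2 * c)^2 * (w * ((w' - c) * (2 - w')))"
    by (simp only: mult.left_commute[of "(2 * c)^2"]) (simp only: mult.left_commute)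
  then have "w' * ((w - c) * (2 - w)) = w * ((w' - c) * (2 - w'))"
    using c by simp
  \<comment> \<open>Vieta in product form: the linear coefficient, which carries the area, drops out.\<close>
  then have "(w' - w) * (w * w' - 2 * c) = 0"
    by (simp add: algebra_simps)
  then consider "w' = w" | "w * w' = 2 * c" by auto
  then show ?thesis
  proof cases
    case 1
    then have "k' = k" using k k' w by (metis mult_right_cancel)
    with 1 show ?thesis by (simp add: w_def w'_def)
  next
    case 2
    then have "w' = k" using k w by (metis mult.commute mult_right_cancel)
    moreover have "k' = w" using 2 k' w by (metis mult_right_cancel)
    ultimately show ?thesis by (auto simp: w_def w'_def)
  qed
qed

text \<open>With \<open>w = 1 - q\<close> the perimeter equation is \<open>2 (1 - \<rho>) = k w\<close>, and substituting it turns the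
  sides of \<open>k tau \<rho> q\<close> into \<open>k w (2 - k)\<close>, \<open>k w (2 - w)\<close> and \<open>k w (k + w - k w)\<close>. Interchanging
  \<open>k\<close> and \<open>w\<close> therefore interchanges the first two and fixes the third.\<close>

lemma involution_swaps_sides:
  assumes "k * (1 - q) = 2 * (1 - \<rho>)"
  shows "scale_triangle (1 - q) (tau \<rho> (1 - k)) = swap_first_two (scale_triangle k (tau \<rho> q))"
proof -
  have \<rho>: "\<rho> = 1 - k * (1 - q) / 2" using assms by (simp add: field_simps)
  show ?thesis unfolding \<rho>
    by (simp add: tau_def power2_eq_square field_simps)
qed

lemma congruent_triangles_swap_first_two: "congruent_triangles (swap_first_two T) T"
  by (cases T) (simp add: congruent_triangles_def add_mset_commute)

text \<open>The second parameter of the involution, \<open>1 - k\<close>, as a function of \<open>q\<close> alone.\<close>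

lemma one_minus_scale_eq:
  fixes \<rho> q k :: rat
  assumes "k * (1 - q) = 2 * (1 - \<rho>)" and "q \<noteq> 1"
  shows "1 - k = (2 * \<rho> - 1 - q) / (1 - q)"
  using assms by (simp add: field_simps)

lemma solutions_congruent:
  assumes "\<rho> \<noteq> 1" and "is_solution \<rho> u k q" and "is_solution \<rho> u k' q'"
  shows "congruent_triangles (scale_triangle k' (tau \<rho> q')) (scale_triangle k (tau \<rho> q))"
  using solution_unique_up_to_involution[OF assms]
proof
  assume "(k', q') = (k, q)"
  then show ?thesis by (simp add: congruent_triangles_def)
next
  assume "k' = 1 - q \<and> q' = 1 - k"
  moreover have "k * (1 - q) = 2 * (1 - \<rho>)"
    using assms(2) by (simp add: is_solution_def)
  ultimately show ?thesis
    by (simp add: involution_swaps_sides congruent_triangles_swap_first_two)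
qed

theorem proposition6p3:
  fixes \<rho> u :: rat
  assumes "-1 < \<rho>" and "\<rho> < 1"
    and "- sqrt (1 - (of_rat \<rho>)^2) < (of_rat u :: real)" and "u < 0"
  shows "(\<forall>k q. genuine_pair \<rho> u k q \<longrightarrow>
           (\<forall>k' q'. is_solution \<rho> u k' q' \<and> (k', q') \<noteq> (k, q) \<longrightarrow>
              congruent_triangles (scale_triangle k' (tau \<rho> q')) (scale_triangle k (tau \<rho> q)) \<and>
              q' = (2 * \<rho> - 1 - q) / (1 - q) \<and> k' = 1 - q) \<and>
           (let q' = (2 * \<rho> - 1 - q) / (1 - q); k' = 1 - q in
              scale_triangle k' (tau \<rho> q') =
                (k * (1 - q^2), 2 * k * (\<rho> - q), k * (q^2 - 2 * \<rho> * q + 1)) \<and>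
              scale_triangle k' (tau \<rho> q') = swap_first_two (scale_triangle k (tau \<rho> q)))) \<and>
         (\<forall>T T'. genuine_partner \<rho> u T \<and> genuine_partner \<rho> u T' \<longrightarrow> congruent_triangles T T')"
proof (intro conjI allI impI)
  have \<rho>: "\<rho> \<noteq> 1" using assms(2) by simp
  show "congruent_triangles T T'" if "genuine_partner \<rho> u T \<and> genuine_partner \<rho> u T'" for T T'
    using that solutions_congruent[OF \<rho>]
    unfolding genuine_partner_def genuine_pair_def by blast
  fix k q
  assume "genuine_pair \<rho> u k q"
  then have sol: "is_solution \<rho> u k q" and "q \<noteq> 1"
    by (auto simp: genuine_pair_def tau_nondegenerate_def)
  then have perimeter: "k * (1 - q) = 2 * (1 - \<rho>)"
    by (simp add: is_solution_def)
  note q' = one_minus_scale_eq[OF perimeter \<open>q \<noteq> 1\<close>]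
  show "let q' = (2 * \<rho> - 1 - q) / (1 - q); k' = 1 - q in
      scale_triangle k' (tau \<rho> q') =
        (k * (1 - q^2), 2 * k * (\<rho> - q), k * (q^2 - 2 * \<rho> * q + 1)) \<and>
      scale_triangle k' (tau \<rho> q') = swap_first_two (scale_triangle k (tau \<rho> q))"
    unfolding Let_def q'[symmetric] involution_swaps_sides[OF perimeter]
    by (simp add: tau_def)
  fix k' q'
  assume other: "is_solution \<rho> u k' q' \<and> (k', q') \<noteq> (k, q)"
  then show "congruent_triangles (scale_triangle k' (tau \<rho> q')) (scale_triangle k (tau \<rho> q))"
    using solutions_congruent[OF \<rho> sol] by blast
  have "k' = 1 - q \<and> q' = 1 - k"
    using other solution_unique_up_to_involution[OF \<rho> sol] by blast
  then show "q' = (2 * \<rho> - 1 - q) / (1 - q)" and "k' = 1 - q"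
    using q' by simp_all
qed

end
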